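(* Let $r\ge 2$ and let $H$ be an $r$-partite $r$-uniform hypergraph with $n$ vertices and $m$ edges, with vertex partition $V(H)=V_1\sqcup V_2\sqcup\cdots\sqcup V_r$, where $|V_i|=n_i\ge 1$ for $i\in[r]$, such that each edge contains exactly one vertex from each $V_i$. Let $d_j$ denote the degree of vertex $j$ and set \[ s_r(H)=\sum_{i=1}^{r}\sum_{j\in V_i}\left|d_j-\frac{m}{n_i}\right|. \] Then \[ \rho(H)-\frac{m}{\sqrt[r]{n_1n_2\cdots n_r}}\le \left(\frac{s_r(H)}{2}\right)^{\frac{r-1}{r}}. \]
   Context: An $r$-uniform hypergraph $H$ on vertex set $[n]$ has as edges a set of $r$-element subsets of $[n]$ (no multiple edges). The degree $d_i$ of a vertex $i$ is the number of edges containing $i$. $H$ is $r$-partite if $V(H)$ can be partitioned into $r$ sets so that each edge contains at most one vertex from each set (hence, for an $r$-uniform hypergraph, exactly one). The adjacency tensor $\mathcal{A}(H)=(a_{i_1\cdots i_r})$ is the order-$r$, dimension-$n$ tensor with $a_{i_1i_2\cdots i_r}=\frac{1}{(r-1)!}$ if $\{i_1,\dots,i_r\}\in E(H)$ and $0$ otherwise. For a tensor $\mathcal{A}$ and $x\in\mathbb{C}^n$, $(\mathcal{A}x)_i=\sum_{i_2,\dots,i_r=1}^n a_{ii_2\cdots i_r}x_{i_2}\cdots x_{i_r}$; $\lambda\in\mathbb{C}$ is an eigenvalue if $\mathcal{A}x=\lambda x^{[r-1]}$ for some nonzero $x\in\mathbb{C}^n$, where $x^{[r-1]}=(x_1^{r-1},\dots,x_n^{r-1})^{\mathrm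 T}$. The spectral radius $\rho(H)$ is the maximum modulus of the eigenvalues of $\mathcal{A}(H)$. *)

theory Defs
  imports "HOL-Analysis.Analysis"
begin

(* A tensor of order r and dimension n is a function on index lists; only the lists of
   length r with entries in {1..n} are relevant.  A vector of C^n is a function
   nat => complex of which only the coordinates 1, ..., n are relevant. *)

type_synonym tensor = "nat list \<Rightarrow> complex"

definition tensor_apply :: "nat \<Rightarrow> nat \<Rightarrow> tensor \<Rightarrow> (nat \<Rightarrow> complex) \<Rightarrow> nat \<Rightarrow> complex" where
  "tensor_apply r n A x i =
     (\<Sum>js | length js = r - 1 \<and> set js \<subseteq> {1..n}. A (i # js) * prod_list (map x js))"

definition tensor_eigenvalue :: "nat \<Rightarrow> nat \<Rightarrow> tensor \<Rightarrow> complex \<Rightarrow> bool" where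
  "tensor_eigenvalue r n A l \<longleftrightarrow>
     (\<exists>x. (\<exists>i\<in>{1..n}. x i \<noteq> 0) \<and>
          (\<forall>i\<in>{1..n}. tensor_apply r n A x i = l * x i ^ (r - 1)))"

(* The maximum modulus of the eigenvalues.  The supremum is attained whenever there is an
   eigenvalue at all: see tensor_spectral_radius_max below. *)
definition tensor_spectral_radius :: "nat \<Rightarrow> nat \<Rightarrow> tensor \<Rightarrow> real" where
  "tensor_spectral_radius r n A = Sup (cmod ` {l. tensor_eigenvalue r n A l})"

(* A hypergraph on the vertex set {1..n} is given by its set of edges. *)
definition uniform_hypergraph :: "nat \<Rightarrow> nat \<Rightarrow> nat set set \<Rightarrow> bool" where
  "uniform_hypergraph r n E \<longleftrightarrow> (\<forall>e\<in>E. e \<subseteq> {1..n} \<and> card e = r)"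

definition hdegree :: "nat set set \<Rightarrow> nat \<Rightarrow> nat" where
  "hdegree E j = card {e \<in> E. j \<in> e}"

definition adjacency_tensor :: "nat \<Rightarrow> nat set set \<Rightarrow> tensor" where
  "adjacency_tensor r E js = (if set js \<in> E then 1 / fact (r - 1) else 0)"

definition hspectral_radius :: "nat \<Rightarrow> nat \<Rightarrow> nat set set \<Rightarrow> real" where
  "hspectral_radius r n E = tensor_spectral_radius r n (adjacency_tensor r E)"

definition r_partition :: "nat \<Rightarrow> nat \<Rightarrow> nat set set \<Rightarrow> (nat \<Rightarrow> nat set) \<Rightarrow> bool" where
  "r_partition r n E V \<longleftrightarrow>
     (\<Union>i\<in>{1..r}. V i) = {1..n} \<and>
     disjoint_family_on V {1..r} \<and>
     (\<forall>e\<in>E. \<forall>i\<in>{1..r}. card (e \<inter> V i) = 1)"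

definition partite_deviation :: "nat \<Rightarrow> nat set set \<Rightarrow> (nat \<Rightarrow> nat set) \<Rightarrow> real" where
  "partite_deviation r E V =
     (\<Sum>i=1..r. \<Sum>j\<in>V i. \<bar>real (hdegree E j) - real (card E) / real (card (V i))\<bar>)"

lemma finite_index_lists: "finite {js. length js = k \<and> set js \<subseteq> {1..n::nat}}"
  using finite_lists_length_eq[of "{1..n}" k] by (simp add: conj_commute)

lemma tensor_apply_scale:
  "tensor_apply r n A (\<lambda>i. c * x i) i = c ^ (r - 1) * tensor_apply r n A x i"
proof -
  have *: "prod_list (map (\<lambda>i. c * x i) js) = c ^ length js * prod_list (map x js)" for js
    by (induction js) (auto simp: mult_ac)
  show ?thesis
    unfolding tensor_apply_def sum_distrib_left by (intro sum.cong) (auto simp: * mult_ac)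
qed

lemma tensor_apply_cong:
  assumes "\<And>i. i \<in> {1..n} \<Longrightarrow> x i = y i"
  shows "tensor_apply r n A x i = tensor_apply r n A y i"
proof -
  have *: "map x js = map y js" if "set js \<subseteq> {1..n}" for js
    using assms that by (meson map_cong subsetD)
  show ?thesis
    unfolding tensor_apply_def by (intro sum.cong refl arg_cong2[where f = "(*)"] arg_cong[OF *]) blast
qed

lemma norm_tensor_apply_le:
  assumes "\<And>i. i \<in> {1..n} \<Longrightarrow> norm (x i) \<le> 1"
  shows "norm (tensor_apply r n A x i) \<le>
    (\<Sum>js | length js = r - 1 \<and> set js \<subseteq> {1..n}. norm (A (i # js)))"
proof -
  have *: "norm (prod_list (map x js)) \<le> 1" if "set js \<subseteq> {1..n}" for js
    using that
  proof (induction js)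
    case (Cons a js)
    then show ?case using assms[of a] by (auto simp: norm_mult intro!: mult_le_one)
  qed simp
  show ?thesis
    unfolding tensor_apply_def
    by (intro sum_norm_le) (auto simp: norm_mult intro!: mult_left_le *)
qed

lemma continuous_on_tensor_apply:
  fixes f :: "'a::topological_space \<Rightarrow> nat \<Rightarrow> complex"
  assumes "\<And>i. continuous_on S (\<lambda>p. f p i)"
  shows "continuous_on S (\<lambda>p. tensor_apply r n A (f p) i)"
proof -
  have "continuous_on S (\<lambda>p. prod_list (map (f p) js))" for js
    by (induction js) (auto intro!: continuous_intros assms)
  then show ?thesis
    unfolding tensor_apply_def by (intro continuous_intros)
qed

lemma tensor_eigenvalue_normalized:
  assumes "tensor_eigenvalue r n A l"
  obtains x k where "k \<in> {1..n}" "x k = 1"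
    "\<And>i. norm (x i) \<le> 1" "\<And>i. i \<notin> {1..n} \<Longrightarrow> x i = 0"
    "\<And>i. i \<in> {1..n} \<Longrightarrow> tensor_apply r n A x i = l * x i ^ (r - 1)"
proof -
  obtain x j where j: "j \<in> {1..n}" "x j \<noteq> 0"
    and x: "\<And>i. i \<in> {1..n} \<Longrightarrow> tensor_apply r n A x i = l * x i ^ (r - 1)"
    using assms unfolding tensor_eigenvalue_def by blast
  have "Max ((\<lambda>i. norm (x i)) ` {1..n}) \<in> (\<lambda>i. norm (x i)) ` {1..n}"
    using j by (intro Max_in) auto
  then obtain k where k: "k \<in> {1..n}" "norm (x k) = Max ((\<lambda>i. norm (x i)) ` {1..n})"
    by auto
  have le: "norm (x i) \<le> norm (x k)" if "i \<in> {1..n}" for i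
    unfolding k(2) using that by (intro Max_ge) auto
  have nz: "x k \<noteq> 0" using le[OF j(1)] j(2) by auto
  define y where "y = (\<lambda>i. if i \<in> {1..n} then inverse (x k) * x i else 0)"
  have "tensor_apply r n A y i = l * y i ^ (r - 1)" if i: "i \<in> {1..n}" for i
  proof -
    have "tensor_apply r n A y i = tensor_apply r n A (\<lambda>i. inverse (x k) * x i) i"
      by (rule tensor_apply_cong) (auto simp: y_def)
    also have "\<dots> = inverse (x k) ^ (r - 1) * (l * x i ^ (r - 1))"
      by (simp only: tensor_apply_scale x[OF i])
    also have "\<dots> = l * y i ^ (r - 1)"
      using i by (simp add: y_def power_mult_distrib)
    finally show ?thesis .
  qed
  moreover have "norm (y i) \<le> 1" for i
  proof (cases "i \<in> {1..n}")
    case True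
    have "norm (y i) = norm (x i) / norm (x k)"
      using True by (simp add: y_def norm_mult norm_divide norm_inverse divide_inverse)
    then show ?thesis using le[OF True] nz by (simp add: divide_le_eq_1)
  qed (simp only: y_def if_False norm_zero zero_le_one)
  ultimately show thesis
    using k nz by (intro that[of k y]) (auto simp: y_def)
qed

lemma compact_tensor_eigenvalues: "compact {l. tensor_eigenvalue r n A l}"
proof -
  define C where "C = (\<Sum>i=1..n. \<Sum>js | length js = r - 1 \<and> set js \<subseteq> {1..n}. norm (A (i # js)))"
  define B :: "nat \<Rightarrow> complex set" where "B = (\<lambda>i. if i \<in> {1..n} then cball 0 1 else {0})"
  define T where "T k = {p \<in> cball 0 C \<times> Pi UNIV B. snd p k = 1 \<and>
     (\<forall>i\<in>{1..n}. tensor_apply r n A (snd p) i = fst p * snd p i ^ (r - 1))}" for k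
  have "compactin (product_topology (\<lambda>_. euclidean) UNIV) (PiE UNIV B)"
    by (subst compactin_PiE) (auto simp: B_def)
  then have "compact (Pi UNIV B)"
    by (simp add: euclidean_product_topology PiE_UNIV_domain)
  then have K: "compact (cball (0::complex) C \<times> Pi UNIV B)"
    by (intro compact_Times) auto
  have coord: "continuous_on UNIV (\<lambda>p::complex \<times> (nat \<Rightarrow> complex). snd p i)" for i
    by (rule continuous_on_product_then_coordinatewise[OF continuous_on_snd[OF continuous_on_id]])
  define Z where "Z i = {p. tensor_apply r n A (snd p) i = fst p * snd p i ^ (r - 1)}" for i
  have "closed (Z i)" for i
    unfolding Z_def
    by (intro closed_Collect_eq continuous_on_tensor_apply continuous_on_mult continuous_on_power
        continuous_on_fst continuous_on_id coord)
  moreover have "closed {p::complex \<times> (nat \<Rightarrow> complex). snd p k = 1}" for k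
    by (intro closed_Collect_eq coord continuous_on_const)
  ultimately have "closed ({p. snd p k = 1} \<inter> (\<Inter>i\<in>{1..n}. Z i))" for k
    by (intro closed_Int closed_INT) auto
  moreover have "T k = (cball 0 C \<times> Pi UNIV B) \<inter> ({p. snd p k = 1} \<inter> (\<Inter>i\<in>{1..n}. Z i))" for k
    by (auto simp: T_def Z_def)
  ultimately have "compact (T k)" for k
    using compact_Int_closed[OF K] by metis
  then have "compact (fst ` (\<Union>k\<in>{1..n}. T k))"
    by (intro compact_continuous_image continuous_intros compact_UN) auto
  moreover have "fst ` (\<Union>k\<in>{1..n}. T k) = {l. tensor_eigenvalue r n A l}"
  proof (intro equalityI subsetI)
    fix l assume "l \<in> fst ` (\<Union>k\<in>{1..n}. T k)"
    then obtain k x where "k \<in> {1..n}" "x k = 1"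
      "\<forall>i\<in>{1..n}. tensor_apply r n A x i = l * x i ^ (r - 1)"
      by (auto simp: T_def)
    then have "tensor_eigenvalue r n A l"
      unfolding tensor_eigenvalue_def by (intro exI[of _ x]) (auto intro!: bexI[of _ k])
    then show "l \<in> {l. tensor_eigenvalue r n A l}" by simp
  next
    fix l assume "l \<in> {l. tensor_eigenvalue r n A l}"
    then have "tensor_eigenvalue r n A l" by simp
    then obtain x k where k: "k \<in> {1..n}" "x k = 1"
      and x: "\<And>i. norm (x i) \<le> 1" "\<And>i. i \<notin> {1..n} \<Longrightarrow> x i = 0"
        "\<And>i. i \<in> {1..n} \<Longrightarrow> tensor_apply r n A x i = l * x i ^ (r - 1)"
      by (rule tensor_eigenvalue_normalized) blast
    have "norm l = norm (tensor_apply r n A x k)"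
      using x(3)[OF k(1)] k(2) by simp
    also have "\<dots> \<le> (\<Sum>js | length js = r - 1 \<and> set js \<subseteq> {1..n}. norm (A (k # js)))"
      using x(1) by (intro norm_tensor_apply_le) auto
    also have "\<dots> \<le> C"
      unfolding C_def using k(1)
      by (intro member_le_sum[where f = "\<lambda>i. \<Sum>js | _ js. norm (A (i # js))"]) (auto intro: sum_nonneg)
    finally have "(l, x) \<in> T k"
      using k x by (auto simp: T_def B_def)
    then show "l \<in> fst ` (\<Union>k\<in>{1..n}. T k)"
      using k(1) by force
  qed
  ultimately show ?thesis by simp
qed

lemma tensor_spectral_radius_max:
  assumes "tensor_eigenvalue r n A l"
  shows "\<exists>l. tensor_eigenvalue r n A l \<and> cmod l = tensor_spectral_radius r n A"
    and "cmod l \<le> tensor_spectral_radius r n A"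
proof -
  have c: "compact (cmod ` {l. tensor_eigenvalue r n A l})"
    by (intro compact_continuous_image continuous_intros compact_tensor_eigenvalues)
  have b: "bdd_above (cmod ` {l. tensor_eigenvalue r n A l})"
    using c by (intro bounded_imp_bdd_above compact_imp_bounded)
  have "tensor_spectral_radius r n A \<in> cmod ` {l. tensor_eigenvalue r n A l}"
    unfolding tensor_spectral_radius_def
    using assms c b by (intro closed_contains_Sup compact_imp_closed) auto
  then show "\<exists>l. tensor_eigenvalue r n A l \<and> cmod l = tensor_spectral_radius r n A"
    by auto
  show "cmod l \<le> tensor_spectral_radius r n A"
    unfolding tensor_spectral_radius_def using assms b by (intro cSup_upper) auto
qed

end

(* Let l be an eigenvalue with eigenvector x, and let a_i be the sum of |x_j|^r over V_i.
   Multiplying the eigenvalue equation at j by x_j and summing over V_i gives |l| a_i <= P(|x|)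
   for every i, where P(y) is the sum over the edges e of the product of y_j over e.  Taking the
   geometric mean over i, |l| <= P(z), where z is |x| with every part scaled to r-norm 1.

   To bound P(z), give each edge e the weight w_e, the product of 1 - g_j over e, where
   g_j = max(0, d_j - m/n_i) / d_j for j in V_i.  The weighted degrees are then at most m/n_i,
   so AM-GM bounds the weighted sum by m / (n_1 ... n_r)^(1/r).  The removed weights 1 - w_e lie
   in [0,1] and have sum at most s/2, half the total deviation, so by Hoelder they contribute
   at most (s/2)^((r-1)/r), as the edges are distinct transversals of the parts and hence
   P(z^r) <= 1. *)

theory Submission
  imports Defs "HOL-Combinatorics.Multiset_Permutations" "Jordan_Normal_Form.Spectral_Radius"
begin

section \<open>Existence of eigenvalues\<close>

text \<open>At order 2 the eigenvalue equation is that of a complex matrix, whose spectrum is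
  nonempty. Graphs need this separate argument because 0 need not be an eigenvalue of an adjacency
  matrix.\<close>

lemma tensor_eigenvalue_order_2_exists:
  assumes "n > 0"
  shows "\<exists>l. tensor_eigenvalue 2 n A l"
proof -
  \<comment> \<open>Matrices and their vectors are indexed from 0, tensors and theirs from 1; hence
    \<open>Suc\<close> here and \<open>j - 1\<close> in \<open>x\<close>.\<close>
  define M where "M = mat n n (\<lambda>(i, j). A [Suc i, Suc j])"
  have M: "M \<in> carrier_mat n n" by (simp add: M_def)
  obtain l where "l \<in> spectrum M"
    using spectrum_non_empty[OF M assms] by blast
  then obtain v where v: "v \<in> carrier_vec n" "v \<noteq> 0\<^sub>v n" "M *\<^sub>v v = l \<cdot>\<^sub>v v"
    using M by (auto simp: spectrum_def eigenvalue_def eigenvector_def)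
  define x where "x j = vec_index v (j - 1)" for j
  have "\<exists>i\<in>{1..n}. x i \<noteq> 0"
  proof (rule ccontr)
    assume "\<not> ?thesis"
    then have "vec_index v i = 0" if "i < n" for i
      using that by (auto simp: x_def dest!: bspec[of _ _ "Suc i"])
    then have "v = 0\<^sub>v n" using v(1) by (intro eq_vecI) auto
    with v(2) show False by simp
  qed
  moreover have "tensor_apply 2 n A x i = l * x i ^ (2 - 1)" if i: "i \<in> {1..n}" for i
  proof -
    have *: "{js. length js = 2 - 1 \<and> set js \<subseteq> {1..n}} = (\<lambda>j. [j]) ` {1..n}"
      by (auto simp: length_Suc_conv)
    have "tensor_apply 2 n A x i = (\<Sum>j\<in>{1..n}. A [i, j] * x j)"
      unfolding tensor_apply_def * by (subst sum.reindex) (auto simp: inj_on_def)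
    also have "\<dots> = (\<Sum>j<n. A [i, Suc j] * vec_index v j)"
      by (simp add: x_def sum.atLeast1_atMost_eq)
    also have "\<dots> = vec_index (M *\<^sub>v v) (i - 1)"
      using v(1) i by (auto simp: M_def scalar_prod_def atLeast0LessThan intro!: sum.cong)
    also have "\<dots> = l * x i ^ (2 - 1)"
      using v(1) i by (auto simp: v(3) x_def intro!: index_smult_vec)
    finally show ?thesis .
  qed
  ultimately show ?thesis unfolding tensor_eigenvalue_def by blast
qed

text \<open>The spectral radius is a supremum, which would be arbitrary for an empty spectrum. For
  \<open>r \<ge> 3\<close> a unit vector is an eigenvector to the eigenvalue \<open>0\<close>, since no edge lies
  in a set of two vertices.\<close>

lemma adjacency_tensor_eigenvalue_exists:
  assumes "r \<ge> 2" "n > 0" "uniform_hypergraph r n E"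
  shows "\<exists>l. tensor_eigenvalue r n (adjacency_tensor r E) l"
proof (cases "r = 2")
  case True
  then show ?thesis using tensor_eigenvalue_order_2_exists assms(2) by blast
next
  case False
  with assms(1) have r: "r \<ge> 3" by simp
  define x :: "nat \<Rightarrow> complex" where "x j = (if j = 1 then 1 else 0)" for j
  have "adjacency_tensor r E (i # js) * prod_list (map x js) = 0" for i js
  proof (cases "set js \<subseteq> {1}")
    case True
    then have "set (i # js) \<subseteq> {i, 1}" by auto
    then have "card (set (i # js)) \<le> card {i, 1::nat}" by (intro card_mono) auto
    also have "\<dots> < r" using r by (simp add: card_insert_if)
    finally have "set (i # js) \<notin> E" using assms(3) unfolding uniform_hypergraph_def by auto
    then show ?thesis unfolding adjacency_tensor_def by (simp only: if_False mult_zero_left)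
  next
    case False
    then have "0 \<in> set (map x js)" by (auto simp: x_def)
    then have "prod_list (map x js) = 0" by (simp add: prod_list_zero_iff)
    then show ?thesis by simp
  qed
  then have "tensor_apply r n (adjacency_tensor r E) x i = 0" for i
    unfolding tensor_apply_def by simp
  moreover have "x 1 \<noteq> 0" "1 \<in> {1..n}" using assms(2) by (auto simp: x_def)
  ultimately show ?thesis
    unfolding tensor_eigenvalue_def by (intro exI[of _ 0] exI[of _ x]) (use r in auto)
qed

section \<open>The adjacency tensor as a sum over edges\<close>

text \<open>The \<open>(r - 1)!\<close> orderings of \<open>e - {i}\<close> contribute equally for
  each edge \<open>e\<close> through \<open>i\<close>, which cancels the factor
  \<open>1 / fact (r - 1)\<close> in the tensor.\<close>

lemma adjacency_tensor_apply:
  assumes "uniform_hypergraph r n E" "r \<ge> 1"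
  shows "tensor_apply r n (adjacency_tensor r E) x i = (\<Sum>e | e \<in> E \<and> i \<in> e. \<Prod>j\<in>e - {i}. x j)"
proof -
  have E: "e \<subseteq> {1..n}" "card e = r" "finite e" if "e \<in> E" for e
    using assms(1) that finite_subset[of e "{1..n}"] by (auto simp: uniform_hypergraph_def)
  have "E \<subseteq> Pow {1..n}" using E by auto
  then have finE: "finite {e \<in> E. i \<in> e}"
    using finite_subset[of E "Pow {1..n}"] by simp
  let ?f = "\<lambda>js. adjacency_tensor r E (i # js) * prod_list (map x js)"
  let ?P = "\<lambda>e. permutations_of_set (e - {i})"
  have "tensor_apply r n (adjacency_tensor r E) x i = sum ?f (\<Union>e\<in>{e \<in> E. i \<in> e}. ?P e)"
    unfolding tensor_apply_def
  proof (rule sum.mono_neutral_right[OF finite_index_lists])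
    show "(\<Union>e\<in>{e \<in> E. i \<in> e}. ?P e) \<subseteq> {js. length js = r - 1 \<and> set js \<subseteq> {1..n}}"
    proof clarify
      fix e js assume e: "e \<in> E" "i \<in> e" and js: "js \<in> ?P e"
      then have "length js = card (e - {i})"
        using distinct_card[of js] by (auto simp: permutations_of_set_def)
      then show "length js = r - 1 \<and> set js \<subseteq> {1..n}"
        using e js E[of e] by (auto simp: permutations_of_set_def)
    qed
    \<comment> \<open>A list of \<open>r\<close> entries that spans an edge of \<open>r\<close>
      vertices has no repetition, so \<open>js\<close> would be an ordering of the edge without
      \<open>i\<close>.\<close>
    have "set (i # js) \<notin> E"
      if "length js = r - 1" "js \<notin> (\<Union>e\<in>{e \<in> E. i \<in> e}. ?P e)" for js
    proof
      assume e: "set (i # js) \<in> E"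
      from E(2)[OF this] have c: "card (insert i (set js)) = r" by simp
      have "card (set js) \<le> r - 1" using card_length[of js] that(1) by simp
      with c assms(2) have "i \<notin> set js" by (auto simp: insert_absorb)
      with c have "card (set js) = length js" using that(1) by simp
      then have "distinct js" by (rule card_distinct)
      with \<open>i \<notin> set js\<close> have "js \<in> ?P (set (i # js))"
        by (auto simp: permutations_of_set_def)
      with e that(2) show False by auto
    qed
    then show "\<forall>js\<in>{js. length js = r - 1 \<and> set js \<subseteq> {1..n}} - (\<Union>e\<in>{e \<in> E. i \<in> e}. ?P e). ?f js = 0"
      unfolding adjacency_tensor_def by auto
  qed
  \<comment> \<open>The union is disjoint, since \<open>js\<close> determines its edge as
    \<open>insert i (set js)\<close>.\<close>
  also have "\<dots> = (\<Sum>e | e \<in> E \<and> i \<in> e. sum ?f (?P e))"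
    using finE E
    by (subst sum.UNION_disjoint) (simp_all, auto simp: permutations_of_set_def)
  also have "\<dots> = (\<Sum>e | e \<in> E \<and> i \<in> e. \<Prod>j\<in>e - {i}. x j)"
  proof (rule sum.cong[OF refl])
    fix e assume "e \<in> {e \<in> E. i \<in> e}"
    then have e: "e \<in> E" "i \<in> e" by auto
    have "?f js = 1 / fact (r - 1) * (\<Prod>j\<in>e - {i}. x j)" if "js \<in> ?P e" for js
    proof -
      have js: "set js = e - {i}" "distinct js" using that by (auto simp: permutations_of_set_def)
      then have "set (i # js) = e" using e(2) by auto
      moreover have "prod_list (map x js) = (\<Prod>j\<in>e - {i}. x j)"
        unfolding js(1)[symmetric] using js(2) by (simp add: prod.distinct_set_conv_list)
      ultimately show ?thesis using e(1) by (simp add: adjacency_tensor_def)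
    qed
    then have "sum ?f (?P e) = of_nat (card (?P e)) * (1 / fact (r - 1) * (\<Prod>j\<in>e - {i}. x j))"
      by simp
    also have "\<dots> = (\<Prod>j\<in>e - {i}. x j)"
      using E[OF e(1)] e(2) by simp
    finally show "sum ?f (?P e) = (\<Prod>j\<in>e - {i}. x j)" .
  qed
  finally show ?thesis .
qed

section \<open>Roots of products and a form of Hoelder's inequality\<close>

lemma real_root_prod: "n > 0 \<Longrightarrow> root n (prod f A) = (\<Prod>x\<in>A. root n (f x))"
  by (induction A rule: infinite_finite_induct) (auto simp: real_root_mult)

text \<open>Hoelder with exponents \<open>r / (r - 1)\<close> and \<open>r\<close>, where
  \<open>u \<le> 1\<close> permits replacing the power of \<open>u\<close> by \<open>u\<close>
  itself. The proof sums Young's inequality for the normalized terms \<open>u e / U\<close> and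
  \<open>q e ^ r\<close>.\<close>

lemma weighted_sum_le_powr:
  fixes u q :: "'a \<Rightarrow> real"
  assumes "r \<ge> 1" "finite A"
    and u: "\<And>e. e \<in> A \<Longrightarrow> 0 \<le> u e" "\<And>e. e \<in> A \<Longrightarrow> u e \<le> 1"
    and q: "\<And>e. e \<in> A \<Longrightarrow> 0 \<le> q e" "(\<Sum>e\<in>A. q e ^ r) \<le> 1"
  shows "(\<Sum>e\<in>A. u e * q e) \<le> sum u A powr ((real r - 1) / real r)"
proof (cases "sum u A = 0")
  case True
  then have "u e = 0" if "e \<in> A" for e
    using that assms(2) u(1) by (simp add: sum_nonneg_eq_0_iff)
  then show ?thesis by simp
next
  case False
  define U where "U = sum u A"
  define a where "a = (real r - 1) / real r"
  define b where "b = 1 / real r"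
  have ab: "0 \<le> a" "0 \<le> b" "a + b = 1" "a \<le> 1" "real r * b = 1"
    using assms(1) by (auto simp: a_def b_def field_simps)
  have U: "U > 0" using False sum_nonneg[of A u] u(1) by (simp add: U_def)
  have "u e * q e \<le> U powr a * (a * (u e / U) + b * q e ^ r)" if e: "e \<in> A" for e
  proof (cases "u e = 0 \<or> q e = 0")
    case True
    have "0 \<le> U powr a * (a * (u e / U) + b * q e ^ r)"
      using ab U u(1)[OF e] q(1)[OF e] by simp
    with True show ?thesis by auto
  next
    case False
    then have pos: "u e > 0" "q e > 0" using u(1)[OF e] q(1)[OF e] by auto
    have "u e * q e = u e powr 1 * q e" using pos by simp
    \<comment> \<open>As \<open>u e \<le> 1\<close>, lowering the exponent from 1 to
      \<open>a\<close> does not decrease the power.\<close>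
    also have "\<dots> \<le> u e powr a * q e"
      using pos ab u(2)[OF e] by (intro mult_right_mono powr_mono') auto
    also have "\<dots> = U powr a * ((u e / U) powr a * (q e ^ r) powr b)"
      using pos U ab(5) by (simp add: powr_divide powr_powr flip: powr_realpow)
    also have "\<dots> \<le> U powr a * (a * (u e / U) + b * q e ^ r)"
      using pos U ab by (intro mult_left_mono Youngs_inequality_0) auto
    finally show ?thesis .
  qed
  then have "(\<Sum>e\<in>A. u e * q e) \<le> (\<Sum>e\<in>A. U powr a * (a * (u e / U) + b * q e ^ r))"
    by (rule sum_mono)
  also have "\<dots> = U powr a * (a * (\<Sum>e\<in>A. u e / U) + b * (\<Sum>e\<in>A. q e ^ r))"
    by (simp add: sum_distrib_left sum.distrib distrib_left)
  also have "(\<Sum>e\<in>A. u e / U) = 1"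
    using U by (simp add: U_def flip: sum_divide_distrib)
  also have "U powr a * (a * 1 + b * (\<Sum>e\<in>A. q e ^ r)) \<le> U powr a * (a * 1 + b * 1)"
    using q(2) ab by (intro mult_left_mono add_left_mono) auto
  finally show ?thesis using ab by (simp add: U_def a_def)
qed

section \<open>Parts, transversal edges and double counting\<close>

locale partite_hypergraph =
  fixes r n :: nat and E :: "nat set set" and V :: "nat \<Rightarrow> nat set"
  assumes r_ge_2: "r \<ge> 2"
    and uniform: "uniform_hypergraph r n E"
    and partition: "r_partition r n E V"
    and card_part_ge_1: "i \<in> {1..r} \<Longrightarrow> card (V i) \<ge> 1"
begin

definition part_of :: "nat \<Rightarrow> nat" where
  "part_of j = (THE i. i \<in> {1..r} \<and> j \<in> V i)"

lemma part_eqI: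
  assumes "i \<in> {1..r}" "j \<in> V i"
  shows "part_of j = i"
  unfolding part_of_def
proof (rule the_equality)
  fix k assume "k \<in> {1..r} \<and> j \<in> V k"
  moreover have "V k \<inter> V i = {}" if "k \<in> {1..r}" "k \<noteq> i"
    using that assms(1) partition unfolding r_partition_def disjoint_family_on_def by blast
  ultimately show "k = i" using assms(2) by blast
qed (use assms in auto)

lemma part_mem:
  assumes "j \<in> {1..n}"
  shows "part_of j \<in> {1..r}" "j \<in> V (part_of j)"
proof -
  have "j \<in> (\<Union>i\<in>{1..r}. V i)"
    using assms partition by (simp only: r_partition_def)
  then obtain i where "i \<in> {1..r}" "j \<in> V i" by (elim UN_E)
  then show "part_of j \<in> {1..r}" "j \<in> V (part_of j)" using part_eqI by metis+
qed

lemma part_subset: "i \<in> {1..r} \<Longrightarrow> V i \<subseteq> {1..n}"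
  using partition by (auto simp: r_partition_def)

lemma finite_part: "i \<in> {1..r} \<Longrightarrow> finite (V i)"
  using part_subset finite_subset by blast

lemma edge:
  assumes "e \<in> E"
  shows edge_subset: "e \<subseteq> {1..n}" and card_edge: "card e = r" and finite_edge: "finite e"
  using uniform assms finite_subset[of e "{1..n}"] by (auto simp: uniform_hypergraph_def)

lemma finite_edges: "finite E"
  using edge_subset finite_subset[of E "Pow {1..n}"] by auto

lemma card_edge_Int_part: "e \<in> E \<Longrightarrow> i \<in> {1..r} \<Longrightarrow> card (e \<inter> V i) = 1"
  using partition by (auto simp: r_partition_def)

text \<open>An edge meets every part, so \<open>part_of\<close> maps it onto \<open>{1..r}\<close>;
  both sets have \<open>r\<close> elements, which gives injectivity.\<close>

lemma bij_betw_part: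
  assumes e: "e \<in> E"
  shows "bij_betw part_of e {1..r}"
proof -
  have "part_of ` e = {1..r}"
  proof
    show "part_of ` e \<subseteq> {1..r}" using part_mem(1) edge_subset[OF e] by auto
    show "{1..r} \<subseteq> part_of ` e"
    proof
      fix i assume i: "i \<in> {1..r}"
      then have "e \<inter> V i \<noteq> {}" using card_edge_Int_part[OF e i] by auto
      then show "i \<in> part_of ` e" using part_eqI[OF i] by force
    qed
  qed
  moreover from this have "inj_on part_of e"
    using card_edge[OF e] finite_edge[OF e] by (intro eq_card_imp_inj_on) auto
  ultimately show ?thesis by (simp add: bij_betw_def)
qed

lemma prod_edge_part: "e \<in> E \<Longrightarrow> (\<Prod>j\<in>e. f (part_of j)) = prod f {1..r}"
  by (rule prod.reindex_bij_betw[OF bij_betw_part])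

lemma sum_parts: "(\<Sum>i=1..r. sum f (V i)) = sum f {1..n}"
proof -
  have "sum f (\<Union>i\<in>{1..r}. V i) = (\<Sum>i=1..r. sum f (V i))"
    using finite_part partition
    by (intro sum.UNION_disjoint) (auto simp: r_partition_def disjoint_family_on_def)
  moreover have "(\<Union>i\<in>{1..r}. V i) = {1..n}"
    using partition by (simp add: r_partition_def)
  ultimately show ?thesis by simp
qed

lemma sum_edges_vertices:
  fixes h :: "nat set \<Rightarrow> nat \<Rightarrow> real"
  shows "(\<Sum>e\<in>E. \<Sum>j\<in>e. h e j) = (\<Sum>j=1..n. \<Sum>e | e \<in> E \<and> j \<in> e. h e j)"
proof -
  have "(\<Sum>e\<in>E. \<Sum>j\<in>e. h e j) = (\<Sum>e\<in>E. \<Sum>j | j \<in> {1..n} \<and> j \<in> e. h e j)"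
    using edge_subset by (intro sum.cong refl) blast
  also have "\<dots> = (\<Sum>j=1..n. \<Sum>e | e \<in> E \<and> j \<in> e. h e j)"
    using finite_edges by (intro sum.swap_restrict) auto
  finally show ?thesis .
qed

text \<open>Exchanging the sums counts each edge once, at its only vertex in \<open>V i\<close>. For
  constant \<open>f\<close> this says that the degrees in a part add up to the number of
  edges.\<close>

lemma sum_part_edges:
  fixes f :: "nat set \<Rightarrow> real"
  assumes i: "i \<in> {1..r}"
  shows "(\<Sum>j\<in>V i. \<Sum>e | e \<in> E \<and> j \<in> e. f e) = sum f E"
proof -
  have "(\<Sum>j\<in>V i. \<Sum>e | e \<in> E \<and> j \<in> e. f e) = (\<Sum>e\<in>E. \<Sum>j | j \<in> V i \<and> j \<in> e. f e)"
    using finite_edges finite_part[OF i] by (intro sum.swap_restrict) auto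
  also have "\<dots> = sum f E"
  proof (rule sum.cong[OF refl])
    fix e assume "e \<in> E"
    then have "card {j. j \<in> V i \<and> j \<in> e} = 1"
      using card_edge_Int_part[OF _ i] by (simp add: Int_def conj_commute)
    then show "(\<Sum>j | j \<in> V i \<and> j \<in> e. f e) = f e" by simp
  qed
  finally show ?thesis .
qed

section \<open>Degree excess and edge weights\<close>

definition excess :: "nat \<Rightarrow> real" where
  "excess j = max 0 (real (hdegree E j) - real (card E) / real (card (V (part_of j))))"

text \<open>The deviations within a part add up to 0, because \<open>m / n_i\<close> is its average
  degree; so their positive parts make up half of the absolute sum.\<close>

lemma sum_excess: "(\<Sum>j=1..n. excess j) = partite_deviation r E V / 2"
proof -
  have "(\<Sum>j\<in>V i. excess j) =
    (\<Sum>j\<in>V i. \<bar>real (hdegree E j) - real (card E) / real (card (V i))\<bar>) / 2"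
    if i: "i \<in> {1..r}" for i
  proof -
    let ?t = "\<lambda>j. real (hdegree E j) - real (card E) / real (card (V i))"
    have "(\<Sum>j\<in>V i. real (hdegree E j)) = real (card E)"
      using sum_part_edges[OF i, of "\<lambda>_. 1"] by (simp add: hdegree_def)
    then have 0: "sum ?t (V i) = 0"
      using card_part_ge_1[OF i] by (simp add: sum_subtractf)
    have "(\<Sum>j\<in>V i. excess j) = (\<Sum>j\<in>V i. (\<bar>?t j\<bar> + ?t j) / 2)"
      by (rule sum.cong) (auto simp: excess_def part_eqI[OF i] max_def abs_if)
    also have "\<dots> = (\<Sum>j\<in>V i. \<bar>?t j\<bar>) / 2"
      using 0 by (simp add: sum.distrib flip: sum_divide_distrib)
    finally show ?thesis .
  qed
  then have "(\<Sum>i=1..r. \<Sum>j\<in>V i. excess j) = partite_deviation r E V / 2"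
    by (simp add: partite_deviation_def sum_divide_distrib)
  then show ?thesis by (simp only: sum_parts)
qed

text \<open>The value is \<open>0\<close> at isolated vertices, in agreement with their excess.\<close>

definition cut_ratio :: "nat \<Rightarrow> real" where
  "cut_ratio j = excess j / real (hdegree E j)"

lemma cut_bounds: "cut_ratio j \<in> {0..1}"
proof -
  have "excess j \<le> real (hdegree E j)" by (simp add: excess_def)
  then show ?thesis
    by (cases "hdegree E j = 0") (auto simp: cut_ratio_def excess_def divide_le_eq_1)
qed

lemma hdegree_mult_cut: "real (hdegree E j) * cut_ratio j = excess j"
  by (cases "hdegree E j = 0") (auto simp: cut_ratio_def excess_def)

text \<open>A product meets both needs: it is at most each of its factors, which caps the weighted
  degrees, and it falls short of 1 by at most the sum of the cut ratios, which limits the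
  loss.\<close>

definition weight :: "nat set \<Rightarrow> real" where
  "weight e = (\<Prod>j\<in>e. 1 - cut_ratio j)"

lemma weight_bounds: "0 \<le> weight e" "weight e \<le> 1"
  using cut_bounds unfolding weight_def by (auto intro!: prod_nonneg prod_le_1)

text \<open>Keeping only the factor at \<open>j\<close> leaves the degree minus its excess, that is,
  the minimum of \<open>d_j\<close> and \<open>m / n_i\<close>.\<close>

lemma weighted_degree_le:
  "(\<Sum>e | e \<in> E \<and> j \<in> e. weight e) \<le> real (card E) / real (card (V (part_of j)))"
proof -
  have "weight e \<le> 1 - cut_ratio j" if "e \<in> E" "j \<in> e" for e
  proof -
    have "weight e = (1 - cut_ratio j) * (\<Prod>k\<in>e - {j}. 1 - cut_ratio k)"
      unfolding weight_def using finite_edge[OF that(1)] that(2) by (rule prod.remove)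
    also have "\<dots> \<le> (1 - cut_ratio j) * 1"
      using cut_bounds by (intro mult_left_mono prod_le_1) auto
    finally show ?thesis by simp
  qed
  then have "(\<Sum>e | e \<in> E \<and> j \<in> e. weight e) \<le> (\<Sum>e | e \<in> E \<and> j \<in> e. 1 - cut_ratio j)"
    by (intro sum_mono) auto
  also have "\<dots> = real (hdegree E j) - excess j"
    using hdegree_mult_cut[of j] by (simp add: hdegree_def algebra_simps)
  also have "\<dots> \<le> real (card E) / real (card (V (part_of j)))"
    by (simp add: excess_def)
  finally show ?thesis .
qed

text \<open>By the Weierstrass product inequality an edge loses at most the sum of its cut ratios.
  Over all edges, \<open>j\<close> contributes its ratio once per incident edge, hence
  \<open>excess j\<close> in total.\<close>

lemma sum_removed_weight_le: "(\<Sum>e\<in>E. 1 - weight e) \<le> partite_deviation r E V / 2"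
proof -
  have "1 - weight e \<le> (\<Sum>j\<in>e. cut_ratio j)" for e
    using Weierstrass_prod_ineq[of e cut_ratio] cut_bounds unfolding weight_def by fastforce
  then have "(\<Sum>e\<in>E. 1 - weight e) \<le> (\<Sum>e\<in>E. \<Sum>j\<in>e. cut_ratio j)"
    by (rule sum_mono)
  also have "\<dots> = (\<Sum>j=1..n. excess j)"
    by (simp add: sum_edges_vertices hdegree_mult_cut flip: hdegree_def)
  finally show ?thesis by (simp only: sum_excess)
qed

section \<open>Bounds for the edge polynomial\<close>

text \<open>Expanding the right side gives a sum over all transversals of the parts; the edges are
  distinct transversals, and the remaining terms are nonnegative.\<close>

lemma sum_edges_prod_le:
  fixes f :: "nat \<Rightarrow> real"
  assumes f: "\<And>j. 0 \<le> f j"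
  shows "(\<Sum>e\<in>E. \<Prod>j\<in>e. f j) \<le> (\<Prod>i=1..r. \<Sum>j\<in>V i. f j)"
proof -
  \<comment> \<open>\<open>g e\<close> picks the vertex of \<open>e\<close> in each part. The
    restriction places it in \<open>PiE\<close>, and \<open>e\<close> is recovered as its image, so
    \<open>g\<close> is injective on \<open>E\<close>.\<close>
  define g where "g e = restrict (inv_into e part_of) {1..r}" for e
  have im: "g e ` {1..r} = e" if "e \<in> E" for e
    using bij_betw_imp_surj_on[OF bij_betw_inv_into[OF bij_betw_part[OF that]]]
    unfolding g_def image_restrict_eq .
  have "(\<Sum>e\<in>E. \<Prod>j\<in>e. f j) = (\<Sum>e\<in>E. \<Prod>i=1..r. f (g e i))"
  proof (rule sum.cong[OF refl])
    fix e assume "e \<in> E"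
    then have "(\<Prod>i\<in>{1..r}. f (inv_into e part_of i)) = (\<Prod>j\<in>e. f j)"
      by (intro prod.reindex_bij_betw bij_betw_inv_into bij_betw_part)
    then show "(\<Prod>j\<in>e. f j) = (\<Prod>i=1..r. f (g e i))" by (simp add: g_def)
  qed
  also have "\<dots> = (\<Sum>h\<in>g ` E. \<Prod>i=1..r. f (h i))"
    using im by (subst sum.reindex) (simp_all add: inj_on_inverseI[of _ "\<lambda>h. h ` {1..r}"])
  also have "\<dots> \<le> (\<Sum>h\<in>PiE {1..r} V. \<Prod>i=1..r. f (h i))"
  proof (rule sum_mono2)
    show "finite (PiE {1..r} V)" using finite_part by (intro finite_PiE) auto
    have "g e i \<in> V i" if "e \<in> E" "i \<in> {1..r}" for e i
    proof -
      have "g e i \<in> e" using im[OF that(1)] that(2) by blast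
      moreover have "part_of (g e i) = i"
        using that bij_betw_inv_into_right[OF bij_betw_part[OF that(1)]] by (simp add: g_def)
      ultimately show ?thesis using part_mem(2)[of "g e i"] edge_subset[OF that(1)] by auto
    qed
    then show "g ` E \<subseteq> PiE {1..r} V" by (auto simp: g_def)
  qed (use f in \<open>auto intro: prod_nonneg\<close>)
  also have "\<dots> = (\<Prod>i=1..r. \<Sum>j\<in>V i. f j)"
    using finite_part by (subst prod_sum_PiE) auto
  finally show ?thesis .
qed

text \<open>AM-GM is applied on each edge to the numbers \<open>n_i * z j ^ r\<close>, whose
  geometric mean is the root of \<open>n_1 ... n_r\<close> times the product of the
  \<open>z j\<close>.\<close>

lemma sum_weight_prod_le:
  fixes z :: "nat \<Rightarrow> real"
  assumes z: "\<And>j. 0 \<le> z j" "\<And>i. i \<in> {1..r} \<Longrightarrow> (\<Sum>j\<in>V i. z j ^ r) \<le> 1"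
  shows "(\<Sum>e\<in>E. weight e * (\<Prod>j\<in>e. z j)) \<le>
    real (card E) / root r (\<Prod>i=1..r. real (card (V i)))"
proof -
  define c where "c i = real (card (V i))" for i
  have c: "c i > 0" if "i \<in> {1..r}" for i using card_part_ge_1[OF that] by (simp add: c_def)
  have r: "r > 0" using r_ge_2 by simp
  have pos: "root r (prod c {1..r}) > 0"
    using r c by (intro real_root_gt_zero prod_pos) auto
  have "root r (prod c {1..r}) * (\<Prod>j\<in>e. z j) \<le> (\<Sum>j\<in>e. c (part_of j) * z j ^ r) / real r"
    if e: "e \<in> E" for e
  proof -
    have "e \<noteq> {}" using card_edge[OF e] r by auto
    have nn: "0 \<le> c i" for i by (simp add: c_def)
    have "root r (prod c {1..r}) * (\<Prod>j\<in>e. z j) = root r (\<Prod>j\<in>e. c (part_of j) * z j ^ r)"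
      using r z(1) by (simp add: prod_edge_part[OF e] real_root_mult
          real_root_prod real_root_power_cancel prod.distrib)
    also have "\<dots> = (\<Prod>j\<in>e. c (part_of j) * z j ^ r) powr (1 / card e)"
      using r z(1) nn by (simp add: root_powr_inverse card_edge[OF e] prod_nonneg)
    also have "\<dots> \<le> (\<Sum>j\<in>e. c (part_of j) * z j ^ r / card e)"
      using z(1) nn finite_edge[OF e] \<open>e \<noteq> {}\<close> by (intro arith_geom_mean) auto
    finally show ?thesis by (simp add: card_edge[OF e] sum_divide_distrib)
  qed
  then have "(\<Sum>e\<in>E. weight e * (root r (prod c {1..r}) * (\<Prod>j\<in>e. z j))) \<le>
      (\<Sum>e\<in>E. weight e * ((\<Sum>j\<in>e. c (part_of j) * z j ^ r) / real r))"
    using weight_bounds by (intro sum_mono mult_left_mono) auto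
  also have "\<dots> = (\<Sum>e\<in>E. \<Sum>j\<in>e. weight e * (c (part_of j) * z j ^ r)) / real r"
    by (simp add: sum_distrib_left sum_divide_distrib)
  also have "\<dots> = (\<Sum>j=1..n. (c (part_of j) * z j ^ r) * (\<Sum>e | e \<in> E \<and> j \<in> e. weight e)) / real r"
    by (simp add: sum_edges_vertices sum_distrib_left mult_ac)
  \<comment> \<open>The cap on the weighted degree cancels the factor \<open>c (part_of j)\<close>
    that AM-GM brought in.\<close>
  also have "\<dots> \<le> (\<Sum>j=1..n. (c (part_of j) * z j ^ r) * (real (card E) / c (part_of j))) / real r"
    using z(1) weighted_degree_le unfolding c_def
    by (intro divide_right_mono sum_mono mult_left_mono) auto
  also have "\<dots> = (\<Sum>j=1..n. real (card E) * z j ^ r) / real r"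
    using c part_mem(1) by (intro arg_cong2[where f = "(/)"] sum.cong) (fastforce simp: field_simps)+
  also have "\<dots> = real (card E) * (\<Sum>i=1..r. \<Sum>j\<in>V i. z j ^ r) / real r"
    by (simp only: sum_parts sum_distrib_left)
  also have "\<dots> \<le> real (card E) * (\<Sum>i=1..r. 1) / real r"
    using z(2) by (intro divide_right_mono mult_left_mono sum_mono) auto
  also have "\<dots> = real (card E)" using r by simp
  finally have "root r (prod c {1..r}) * (\<Sum>e\<in>E. weight e * (\<Prod>j\<in>e. z j)) \<le> real (card E)"
    by (simp add: sum_distrib_left mult_ac)
  then show ?thesis using pos by (simp add: c_def field_simps)
qed

lemma sum_edges_prod_le_deviation:
  fixes z :: "nat \<Rightarrow> real"
  assumes z: "\<And>j. 0 \<le> z j" "\<And>i. i \<in> {1..r} \<Longrightarrow> (\<Sum>j\<in>V i. z j ^ r) \<le> 1"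
  shows "(\<Sum>e\<in>E. \<Prod>j\<in>e. z j) \<le> real (card E) / root r (\<Prod>i=1..r. real (card (V i)))
    + (partite_deviation r E V / 2) powr ((real r - 1) / real r)"
proof -
  \<comment> \<open>This establishes the norm condition of \<open>weighted_sum_le_powr\<close>, with
    the edge products as \<open>q\<close>.\<close>
  have "(\<Sum>e\<in>E. (\<Prod>j\<in>e. z j) ^ r) = (\<Sum>e\<in>E. \<Prod>j\<in>e. z j ^ r)"
    by (simp add: prod_power_distrib)
  also have "\<dots> \<le> (\<Prod>i=1..r. \<Sum>j\<in>V i. z j ^ r)"
    using z(1) by (intro sum_edges_prod_le) auto
  also have "\<dots> \<le> 1"
    using z by (intro prod_le_1) (auto intro: sum_nonneg)
  finally have "(\<Sum>e\<in>E. (1 - weight e) * (\<Prod>j\<in>e. z j)) \<le>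
      (\<Sum>e\<in>E. 1 - weight e) powr ((real r - 1) / real r)"
    using r_ge_2 finite_edges weight_bounds z(1)
    by (intro weighted_sum_le_powr) (auto intro: prod_nonneg)
  also have "\<dots> \<le> (partite_deviation r E V / 2) powr ((real r - 1) / real r)"
    using sum_removed_weight_le weight_bounds r_ge_2 by (intro powr_mono2) (auto intro: sum_nonneg)
  finally have "(\<Sum>e\<in>E. (1 - weight e) * (\<Prod>j\<in>e. z j)) \<le> \<dots>" .
  moreover have "(\<Sum>e\<in>E. \<Prod>j\<in>e. z j) =
      (\<Sum>e\<in>E. weight e * (\<Prod>j\<in>e. z j)) + (\<Sum>e\<in>E. (1 - weight e) * (\<Prod>j\<in>e. z j))"
    by (simp add: algebra_simps flip: sum.distrib)
  ultimately show ?thesis using sum_weight_prod_le[OF z] by linarith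
qed

section \<open>From eigenvectors to the edge polynomial\<close>

text \<open>Multiplying the equation at \<open>j\<close> by \<open>x j\<close> completes each
  product over \<open>e - {j}\<close> to one over \<open>e\<close>, which no longer depends on
  \<open>j\<close>; summing over \<open>V i\<close> then counts every edge once.\<close>

lemma eigenvector_part_le:
  assumes x: "\<And>j. j \<in> {1..n} \<Longrightarrow>
      tensor_apply r n (adjacency_tensor r E) x j = l * x j ^ (r - 1)"
    and i: "i \<in> {1..r}"
  shows "cmod l * (\<Sum>j\<in>V i. cmod (x j) ^ r) \<le> (\<Sum>e\<in>E. \<Prod>j\<in>e. cmod (x j))"
proof -
  have "cmod l * cmod (x j) ^ r \<le> (\<Sum>e | e \<in> E \<and> j \<in> e. \<Prod>k\<in>e. cmod (x k))"
    if j: "j \<in> V i" for j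
  proof -
    have "j \<in> {1..n}" using part_subset[OF i] j by auto
    then have eq: "(\<Sum>e | e \<in> E \<and> j \<in> e. \<Prod>k\<in>e - {j}. x k) = l * x j ^ (r - 1)"
      using x adjacency_tensor_apply[OF uniform, of x j] r_ge_2 by simp
    have "cmod l * cmod (x j) ^ r = cmod (x j) * cmod (l * x j ^ (r - 1))"
      using r_ge_2 by (cases r) (auto simp: norm_mult norm_power)
    also have "\<dots> \<le> cmod (x j) * (\<Sum>e | e \<in> E \<and> j \<in> e. \<Prod>k\<in>e - {j}. cmod (x k))"
      unfolding eq[symmetric] by (intro mult_left_mono sum_norm_le) (auto simp: prod_norm)
    also have "\<dots> = (\<Sum>e | e \<in> E \<and> j \<in> e. \<Prod>k\<in>e. cmod (x k))"
      unfolding sum_distrib_left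
      by (rule sum.cong) (auto simp: finite_edge prod.remove)
    finally show ?thesis .
  qed
  then have "(\<Sum>j\<in>V i. cmod l * cmod (x j) ^ r) \<le>
      (\<Sum>j\<in>V i. \<Sum>e | e \<in> E \<and> j \<in> e. \<Prod>k\<in>e. cmod (x k))"
    by (rule sum_mono)
  then show ?thesis by (simp only: sum_part_edges[OF i] sum_distrib_left)
qed

lemma eigenvalue_norm_le:
  assumes "tensor_eigenvalue r n (adjacency_tensor r E) l"
  shows "cmod l \<le> real (card E) / root r (\<Prod>i=1..r. real (card (V i)))
    + (partite_deviation r E V / 2) powr ((real r - 1) / real r)" (is "_ \<le> ?C")
proof -
  obtain x k where k: "k \<in> {1..n}" "x k \<noteq> 0" and x: "\<And>j. j \<in> {1..n} \<Longrightarrow>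
      tensor_apply r n (adjacency_tensor r E) x j = l * x j ^ (r - 1)"
    using assms unfolding tensor_eigenvalue_def by blast
  define a where "a i = (\<Sum>j\<in>V i. cmod (x j) ^ r)" for i
  define P where "P = (\<Sum>e\<in>E. \<Prod>j\<in>e. cmod (x j))"
  have r: "r > 0" using r_ge_2 by simp
  have a: "0 \<le> a i" "cmod l * a i \<le> P" if "i \<in> {1..r}" for i
    using eigenvector_part_le[OF x that] by (auto simp: a_def P_def intro: sum_nonneg)
  show ?thesis
  proof (cases "\<exists>i\<in>{1..r}. a i = 0")
    \<comment> \<open>No scaling to norm 1 is possible when \<open>x\<close> vanishes on a part. But
      then every edge has a vertex with \<open>x j = 0\<close>, so \<open>P = 0\<close>, and the
      part of \<open>k\<close>, where \<open>a\<close> is positive, forces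
      \<open>l = 0\<close>.\<close>
    case True
    then obtain i where i: "i \<in> {1..r}" "a i = 0" by blast
    then have 0: "x j = 0" if "j \<in> V i" for j
      using that finite_part[OF i(1)] r by (simp add: a_def sum_nonneg_eq_0_iff)
    have "(\<Prod>j\<in>e. cmod (x j)) = 0" if e: "e \<in> E" for e
    proof -
      have "e \<inter> V i \<noteq> {}" using card_edge_Int_part[OF e i(1)] by auto
      then show ?thesis using 0 finite_edge[OF e] by auto
    qed
    then have "P = 0" by (simp add: P_def)
    have "0 < cmod (x k) ^ r" using k by simp
    also have "\<dots> \<le> a (part_of k)"
      unfolding a_def using finite_part part_mem[OF k(1)] by (intro member_le_sum) auto
    finally have "cmod l = 0"
      using a(2)[OF part_mem(1)[OF k(1)]] \<open>P = 0\<close> by (simp add: mult_le_0_iff)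
    moreover have "0 \<le> ?C" by (intro add_nonneg_nonneg divide_nonneg_nonneg real_root_ge_zero prod_nonneg) auto
    ultimately show ?thesis by simp
  next
    case False
    with a(1) have apos: "a i > 0" if "i \<in> {1..r}" for i using that by force
    define b where "b = root r (prod a {1..r})"
    have b: "b > 0" unfolding b_def using r apos by (intro real_root_gt_zero prod_pos) auto
    \<comment> \<open>Every part gets r-norm 1, which divides the edge sum by the geometric mean
      \<open>b\<close>. Outside \<open>{1..n}\<close>, where the partition does not determine
      \<open>part_of\<close>, the value 0 keeps \<open>z\<close> nonnegative.\<close>
    define z where "z j = (if j \<in> {1..n} then cmod (x j) / root r (a (part_of j)) else 0)" for j
    have "0 \<le> z j" for j
      using r a(1) part_mem(1) by (auto simp: z_def intro!: divide_nonneg_nonneg)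
    moreover have "(\<Sum>j\<in>V i. z j ^ r) = 1" if i: "i \<in> {1..r}" for i
    proof -
      have "(\<Sum>j\<in>V i. z j ^ r) = (\<Sum>j\<in>V i. cmod (x j) ^ r / a i)"
        using part_subset[OF i] part_eqI[OF i] apos[OF i] r
        by (intro sum.cong) (auto simp: z_def power_divide)
      also have "\<dots> = 1" using apos[OF i] by (simp add: a_def flip: sum_divide_distrib)
      finally show ?thesis .
    qed
    ultimately have "(\<Sum>e\<in>E. \<Prod>j\<in>e. z j) \<le> ?C"
      by (intro sum_edges_prod_le_deviation) auto
    moreover have "(\<Sum>e\<in>E. \<Prod>j\<in>e. z j) = P / b"
      unfolding P_def sum_divide_distrib
    proof (rule sum.cong[OF refl])
      fix e assume e: "e \<in> E"
      have "(\<Prod>j\<in>e. z j) = (\<Prod>j\<in>e. cmod (x j) / root r (a (part_of j)))"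
        using edge_subset[OF e] by (intro prod.cong) (auto simp: z_def)
      also have "\<dots> = (\<Prod>j\<in>e. cmod (x j)) / (\<Prod>i=1..r. root r (a i))"
        by (simp add: prod_dividef prod_edge_part[OF e, of "\<lambda>i. root r (a i)"])
      also have "(\<Prod>i=1..r. root r (a i)) = b"
        using r by (simp add: b_def real_root_prod)
      finally show "(\<Prod>j\<in>e. z j) = (\<Prod>j\<in>e. cmod (x j)) / b" .
    qed
    \<comment> \<open>The \<open>r\<close> inequalities \<open>cmod l * a i \<le> P\<close> are
      multiplied and the r-th root is taken.\<close>
    moreover have "cmod l * b \<le> P"
    proof (rule power_le_imp_le_base)
      have "(cmod l * b) ^ r = (\<Prod>i=1..r. cmod l * a i)"
        using r a(1) prod_nonneg[of "{1..r}" a] by (simp add: b_def power_mult_distrib prod.distrib)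
      also have "\<dots> \<le> (\<Prod>i=1..r. P)"
        using a by (intro prod_mono) auto
      finally show "(cmod l * b) ^ Suc (r - 1) \<le> P ^ Suc (r - 1)" using r by simp
      show "0 \<le> P" by (auto simp: P_def intro!: sum_nonneg prod_nonneg)
    qed
    ultimately show ?thesis using b by (metis order_trans pos_le_divide_eq)
  qed
qed

end

theorem theorem1p1:
  fixes r n :: nat and E :: "nat set set" and V :: "nat \<Rightarrow> nat set"
  assumes "r \<ge> 2"
    and "uniform_hypergraph r n E"
    and "r_partition r n E V"
    and "\<And>i. i \<in> {1..r} \<Longrightarrow> card (V i) \<ge> 1"
  shows "hspectral_radius r n E - real (card E) / root r (\<Prod>i=1..r. real (card (V i)))
           \<le> (partite_deviation r E V / 2) powr ((real r - 1) / real r)"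
proof -
  interpret partite_hypergraph r n E V
    using assms by unfold_locales
  have "V 1 \<noteq> {}" "V 1 \<subseteq> {1..n}"
    using assms(1) card_part_ge_1[of 1] part_subset[of 1] by auto
  then have "n > 0" by auto
  then obtain l where "tensor_eigenvalue r n (adjacency_tensor r E) l"
    using adjacency_tensor_eigenvalue_exists[OF assms(1) _ assms(2)] by blast
  \<comment> \<open>As the spectrum is nonempty, the supremum is attained at an eigenvalue, to which
    the bound applies.\<close>
  from tensor_spectral_radius_max(1)[OF this] eigenvalue_norm_le show ?thesis
    unfolding hspectral_radius_def by force
qed

end
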